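(* Let $n$ be a positive integer. Then $\operatorname{cone}(\mathcal{B}_+\cup\mathcal{B}_-)=\mathcal{DD}_n$.
   Context: $\mathbb{S}^n$ denotes the space of real symmetric $n\times n$ matrices. Let $e_i\in\mathbb{R}^n$ be the $i$th standard basis vector. Define the SD bases of Type I and Type II by $$\mathcal{B}_+:=\{(e_i+e_j)(e_i+e_j)^T\mid 1\le i\le j\le n\},$$ $$\mathcal{B}_-:=\{(e_i+e_i)(e_i+e_i)^T\mid 1\le i\le n\}\cup\{(e_i-e_j)(e_i-e_j)^T\mid 1\le i<j\le n\}.$$ The set of diagonally dominant matrices is $$\mathcal{DD}_n:=\{A\in\mathbb{S}^n\mid A_{i,i}\ge\sum_{j\ne i}|A_{i,j}|\ (i=1,\ldots,n)\}.$$ For $\mathcal{K}\subseteq\mathbb{S}^n$, the conical hull is $\operatorname{cone}(\mathcal{K}):=\{\sum_{i=1}^k\alpha_iX_i\mid X_i\in\mathcal{K},\ \alpha_i\ge0,\ k\in\mathbb{Z}_{\ge0}\}$, where $\mathbb{Z}_{\ge 0}$ is the set of nonnegative integers (the empty sum is the zero matrix). *)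

theory Defs
  imports "HOL-Analysis.Analysis"
begin

text \<open>
  The index set \<open>{1, ..., n}\<close> is a finite linearly ordered type \<open>'n\<close> with \<open>CARD('n) = n\<close>; the order
  is what the conditions \<open>i \<le> j\<close> and \<open>i < j\<close> in the SD bases refer to. Types are inhabited, so
  \<open>n \<ge> 1\<close> is implicit, and every \<open>n \<ge> 1\<close> occurs through the numeral types.
\<close>

definition sym_mats :: "(real^'n^'n) set"
  where "sym_mats = {A. transpose A = A}"

definition std_basis :: "'n \<Rightarrow> real^'n"
  where "std_basis i = axis i 1"

definition vec_vecT :: "real^'n \<Rightarrow> real^'n^'n"
  where "vec_vecT v = (columnvector v :: real^1^'n) ** transpose (columnvector v)"

definition B_plus :: "(real^'n::{finite,linorder}^'n::{finite,linorder}) set"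
  where "B_plus = {vec_vecT (std_basis i + std_basis j) | i j. i \<le> j}"

definition B_minus :: "(real^'n::{finite,linorder}^'n::{finite,linorder}) set"
  where "B_minus = {vec_vecT (std_basis i + std_basis i) | i. True}
                 \<union> {vec_vecT (std_basis i - std_basis j) | i j. i < j}"

definition DD :: "(real^'n^'n) set"
  where "DD = {A \<in> sym_mats. \<forall>i. A $ i $ i \<ge> (\<Sum>j\<in>UNIV - {i}. \<bar>A $ i $ j\<bar>)}"

text \<open>
  Not the library's \<open>cone hull\<close>, which is only closed under nonnegative scaling and not under sums.
  The case \<open>k = 0\<close> contributes the zero element.
\<close>

definition conical_hull :: "'a::real_vector set \<Rightarrow> 'a set"
  where "conical_hull K =
    {(\<Sum>i<k. \<alpha> i *\<^sub>R X i) | (k::nat) (\<alpha> :: nat \<Rightarrow> real) X. \<forall>i<k. X i \<in> K \<and> 0 \<le> \<alpha> i}"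

end

theory Submission
  imports Defs
begin

text \<open>
  The set \<open>DD\<close> is closed under addition and nonnegative scaling, by the triangle inequality in
  each row, so one inclusion only needs the generators to be diagonally dominant. For a rank-one
  matrix \<open>v v\<^sup>T\<close>, row \<open>k\<close> is dominant iff \<open>v\<^sub>k = 0\<close> or \<open>\<bar>v\<^sub>k\<bar>\<close> is at least half of the l1-norm of
  \<open>v\<close>. The vectors \<open>e\<^sub>i \<plusminus> e\<^sub>j\<close> have integer entries and l1-norm at most 2, so this holds
  (\<open>vec_vecT_in_DD\<close>).

  Conversely, for a diagonally dominant \<open>A\<close> an off-diagonal entry is produced by
  \<open>\<bar>A\<^sub>i\<^sub>j\<bar> (e\<^sub>i + s e\<^sub>j) (e\<^sub>i + s e\<^sub>j)\<^sup>T\<close> with \<open>s\<close> the sign of \<open>A\<^sub>i\<^sub>j\<close>. This adds \<open>\<bar>A\<^sub>i\<^sub>j\<bar>\<close> to the diagonal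
  entries \<open>i\<close> and \<open>j\<close>, so that after all pairs \<open>i < j\<close> the diagonal of \<open>A\<close> still lacks
  \<open>A\<^sub>i\<^sub>i - (\<Sum>j\<noteq>i. \<bar>A\<^sub>i\<^sub>j\<bar>)\<close>; this is nonnegative exactly by diagonal dominance and is supplied by
  multiples of \<open>(e\<^sub>i + e\<^sub>i) (e\<^sub>i + e\<^sub>i)\<^sup>T\<close>. The computation is shorter when the sum runs over all ordered
  pairs \<open>(i, j)\<close> with symmetric weights, each pair \<open>i \<noteq> j\<close> then counting half
  (\<open>symmetric_sum_entry\<close>, \<open>DD_decomposition\<close>); the generators do not depend on the order of
  \<open>i\<close> and \<open>j\<close>.
\<close>

lemma vec_vecT_nth: "vec_vecT v $ k $ l = v $ k * v $ l"
  by (simp add: vec_vecT_def matrix_matrix_mult_def columnvector_def transpose_def)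

lemma std_basis_nth: "std_basis i $ k = (if k = i then 1 else 0)"
  by (simp add: std_basis_def axis_def)

lemma vec_vecT_uminus: "vec_vecT (- v) = vec_vecT v"
  by (simp add: vec_eq_iff vec_vecT_nth)

lemma sum_in_conical_hull:
  assumes "finite I" and "\<And>i. i \<in> I \<Longrightarrow> X i \<in> K" and "\<And>i. i \<in> I \<Longrightarrow> 0 \<le> c i"
  shows "(\<Sum>i\<in>I. c i *\<^sub>R X i) \<in> conical_hull K"
proof -
  obtain h where h: "bij_betw h {..<card I} I"
    using ex_bij_betw_nat_finite[OF assms(1)] by (auto simp: atLeast0LessThan)
  have "(\<Sum>i\<in>I. c i *\<^sub>R X i) = (\<Sum>m<card I. c (h m) *\<^sub>R X (h m))"
    using sum.reindex_bij_betw[OF h, of "\<lambda>i. c i *\<^sub>R X i"] by simp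
  moreover have "\<forall>m<card I. X (h m) \<in> K \<and> 0 \<le> c (h m)"
    using h assms by (auto simp: bij_betw_def)
  ultimately show ?thesis
    unfolding conical_hull_def mem_Collect_eq
    by (intro exI[of _ "card I"] exI[of _ "\<lambda>m. c (h m)"] exI[of _ "\<lambda>m. X (h m)"] conjI)
qed

lemma conical_hull_subset:
  assumes "K \<subseteq> C" and "0 \<in> C"
    and "\<And>x y. x \<in> C \<Longrightarrow> y \<in> C \<Longrightarrow> x + y \<in> C"
    and "\<And>c x. 0 \<le> c \<Longrightarrow> x \<in> C \<Longrightarrow> c *\<^sub>R x \<in> C"
  shows "conical_hull K \<subseteq> C"
proof -
  have "(\<Sum>i<k. \<alpha> i *\<^sub>R X i) \<in> C" if "\<forall>i<k. X i \<in> K \<and> 0 \<le> \<alpha> i" for k :: nat and \<alpha> X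
    using that by (induction k) (use assms in auto)
  then show ?thesis
    unfolding conical_hull_def by blast
qed

lemma zero_in_DD: "0 \<in> DD"
  by (simp add: DD_def sym_mats_def transpose_def vec_eq_iff)

lemma add_in_DD:
  assumes "A \<in> DD" "B \<in> DD"
  shows "A + B \<in> DD"
proof -
  have "(\<Sum>j\<in>UNIV - {i}. \<bar>(A + B) $ i $ j\<bar>) \<le> (A + B) $ i $ i" for i
  proof -
    have "(\<Sum>j\<in>UNIV - {i}. \<bar>(A + B) $ i $ j\<bar>)
        \<le> (\<Sum>j\<in>UNIV - {i}. \<bar>A $ i $ j\<bar> + \<bar>B $ i $ j\<bar>)"
      by (intro sum_mono) (simp add: abs_triangle_ineq)
    also have "\<dots> \<le> A $ i $ i + B $ i $ i"
      using assms by (auto simp: DD_def sum.distrib intro: add_mono)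
    finally show ?thesis by simp
  qed
  then show ?thesis
    using assms by (simp add: DD_def sym_mats_def transpose_def vec_eq_iff)
qed

lemma scaleR_in_DD:
  assumes "0 \<le> c" "A \<in> DD"
  shows "c *\<^sub>R A \<in> DD"
  using assms
  by (auto simp: DD_def sym_mats_def transpose_def vec_eq_iff abs_mult
      sum_distrib_left[symmetric] intro: mult_left_mono)

text \<open>
  A nonzero integer entry has absolute value at least 1, so it leaves at most 1 for the rest of the
  l1-norm.
\<close>

lemma vec_vecT_in_DD:
  assumes int: "\<And>k. v $ k \<in> \<int>" and l1: "(\<Sum>k\<in>UNIV. \<bar>v $ k\<bar>) \<le> 2"
  shows "vec_vecT v \<in> DD"
proof -
  have "(\<Sum>l\<in>UNIV - {k}. \<bar>vec_vecT v $ k $ l\<bar>) \<le> vec_vecT v $ k $ k" for k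
  proof (cases "v $ k = 0")
    case True
    then show ?thesis by (simp add: vec_vecT_nth)
  next
    case False
    then have ge1: "1 \<le> \<bar>v $ k\<bar>"
      using int Ints_nonzero_abs_ge1 by blast
    have "(\<Sum>l\<in>UNIV - {k}. \<bar>v $ l\<bar>) = (\<Sum>l\<in>UNIV. \<bar>v $ l\<bar>) - \<bar>v $ k\<bar>"
      by (simp add: sum_diff1)
    also have "\<dots> \<le> \<bar>v $ k\<bar>"
      using l1 ge1 by linarith
    finally have "\<bar>v $ k\<bar> * (\<Sum>l\<in>UNIV - {k}. \<bar>v $ l\<bar>) \<le> \<bar>v $ k\<bar> * \<bar>v $ k\<bar>"
      by (intro mult_left_mono) auto
    then show ?thesis
      by (simp add: vec_vecT_nth abs_mult sum_distrib_left)
  qed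
  then show ?thesis
    by (simp add: DD_def sym_mats_def transpose_def vec_eq_iff vec_vecT_nth mult.commute)
qed

lemma std_basis_pair_in_DD:
  assumes "s = 1 \<or> s = - 1"
  shows "vec_vecT (std_basis i + s *\<^sub>R std_basis j) \<in> DD"
proof (rule vec_vecT_in_DD)
  show "(std_basis i + s *\<^sub>R std_basis j) $ k \<in> \<int>" for k
    using assms by (auto simp: std_basis_nth)
  have "(\<Sum>k\<in>UNIV. \<bar>(std_basis i + s *\<^sub>R std_basis j) $ k\<bar>)
      \<le> (\<Sum>k\<in>UNIV. (if k = i then 1 else 0) + (if k = j then 1 else 0))"
    using assms by (intro sum_mono) (auto simp: std_basis_nth)
  also have "\<dots> = 2"
    by (simp add: sum.distrib)
  finally show "(\<Sum>k\<in>UNIV. \<bar>(std_basis i + s *\<^sub>R std_basis j) $ k\<bar>) \<le> 2" .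
qed

lemma B_subset_DD: "B_plus \<union> B_minus \<subseteq> (DD :: (real^'n::{finite,linorder}^'n::{finite,linorder}) set)"
proof -
  have "vec_vecT (std_basis i + std_basis j) \<in> DD" for i j :: 'n
    using std_basis_pair_in_DD[of 1] by simp
  moreover have "vec_vecT (std_basis i - std_basis j) \<in> DD" for i j :: 'n
    using std_basis_pair_in_DD[of "- 1"] by simp
  ultimately show ?thesis
    unfolding B_plus_def B_minus_def by blast
qed

text \<open>
  Ordered pairs in either order are allowed since \<open>v v\<^sup>T\<close> does not change when \<open>v\<close> is negated. The
  sign \<open>-1\<close> with \<open>i = j\<close> must be excluded: it would give the zero matrix.
\<close>

lemma std_basis_pair_in_B:
  assumes "s = 1 \<or> s = - 1 \<and> i \<noteq> j"
  shows "vec_vecT (std_basis i + s *\<^sub>R std_basis j) \<in> B_plus \<union> B_minus"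
proof -
  have plus: "vec_vecT (std_basis i + std_basis j) \<in> B_plus"
  proof (cases "i \<le> j")
    case True
    then show ?thesis by (auto simp: B_plus_def)
  next
    case False
    then have "j \<le> i" by simp
    then have "vec_vecT (std_basis j + std_basis i) \<in> B_plus" by (auto simp: B_plus_def)
    then show ?thesis by (simp add: add.commute)
  qed
  have minus: "vec_vecT (std_basis i - std_basis j) \<in> B_minus" if "i \<noteq> j"
  proof (cases "i < j")
    case True
    then show ?thesis by (auto simp: B_minus_def)
  next
    case False
    with that have "j < i" by simp
    then have "vec_vecT (std_basis j - std_basis i) \<in> B_minus" by (auto simp: B_minus_def)
    then show ?thesis
      using vec_vecT_uminus[of "std_basis j - std_basis i"] by simp
  qed
  show ?thesis
    using assms plus minus by auto
qed

text \<open>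
  Expanding \<open>(e\<^sub>i + s e\<^sub>j) (e\<^sub>i + s e\<^sub>j)\<^sup>T\<close> gives two diagonal terms, which contribute the row and the
  column sum of the weights, and two mixed terms; by symmetry each of them counts twice.
\<close>

lemma symmetric_sum_entry:
  fixes w s :: "'n::finite \<Rightarrow> 'n \<Rightarrow> real"
  assumes w: "\<And>i j. w i j = w j i" and s: "\<And>i j. s i j = s j i"
    and sq: "\<And>i j. s i j * s i j = 1"
  shows "(\<Sum>(i, j)\<in>UNIV. w i j *\<^sub>R vec_vecT (std_basis i + s i j *\<^sub>R std_basis j)) $ k $ l
    = (if k = l then 2 * (\<Sum>j\<in>UNIV. w k j) else 0) + 2 * (s k l * w k l)"
proof -
  have "(\<Sum>(i, j)\<in>UNIV. w i j *\<^sub>R vec_vecT (std_basis i + s i j *\<^sub>R std_basis j)) $ k $ l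
      = (\<Sum>i\<in>UNIV. \<Sum>j\<in>UNIV.
          w i j * (((std_basis i + s i j *\<^sub>R std_basis j) $ k)
                 * ((std_basis i + s i j *\<^sub>R std_basis j) $ l)))"
    by (simp add: sum_component case_prod_beta vec_vecT_nth sum.cartesian_product
        flip: UNIV_Times_UNIV)
  also have "\<dots> = (\<Sum>i\<in>UNIV. \<Sum>j\<in>UNIV.
          (if i = k then if k = l then w i j else 0 else 0)
        + (if i = k then if j = l then s i j * w i j else 0 else 0)
        + (if i = l then if j = k then s i j * w i j else 0 else 0)
        + (if j = k then if k = l then w i j else 0 else 0))"
  proof (intro sum.cong refl)
    fix i j
    have sq': "s i j * (s i j * w i j) = w i j"
      using sq[of i j] by (simp flip: mult.assoc)
    show "w i j * (((std_basis i + s i j *\<^sub>R std_basis j) $ k)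
                 * ((std_basis i + s i j *\<^sub>R std_basis j) $ l))
        = (if i = k then if k = l then w i j else 0 else 0)
        + (if i = k then if j = l then s i j * w i j else 0 else 0)
        + (if i = l then if j = k then s i j * w i j else 0 else 0)
        + (if j = k then if k = l then w i j else 0 else 0)"
      using sq' by (auto simp: std_basis_nth algebra_simps)
  qed
  also have "\<dots> = (if k = l then \<Sum>j\<in>UNIV. w k j else 0) + s k l * w k l + s l k * w l k
      + (if k = l then \<Sum>i\<in>UNIV. w i k else 0)"
  proof -
    have out: "(\<Sum>j\<in>UNIV. if P then f j else 0) = (if P then \<Sum>j\<in>UNIV. f j else 0)"
      for P and f :: "'n \<Rightarrow> real"
      by simp
    show ?thesis
      by (simp add: sum.distrib out)
  qed
  also have "\<dots> = (if k = l then 2 * (\<Sum>j\<in>UNIV. w k j) else 0) + 2 * (s k l * w k l)"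
  proof -
    have "(\<Sum>i\<in>UNIV. w i m) = (\<Sum>j\<in>UNIV. w m j)" for m
      by (rule sum.cong[OF refl w])
    then show ?thesis
      using w[of l k] s[of l k] by simp
  qed
  finally show ?thesis .
qed

text \<open>
  Half of \<open>\<bar>A\<^sub>i\<^sub>j\<bar>\<close> because \<open>(i, j)\<close> and \<open>(j, i)\<close> both occur, and a quarter of the slack of the row on
  the diagonal because the only nonzero entry of \<open>(e\<^sub>i + e\<^sub>i) (e\<^sub>i + e\<^sub>i)\<^sup>T\<close> is 4.
\<close>

definition dd_weight :: "real^'n^'n \<Rightarrow> 'n \<Rightarrow> 'n \<Rightarrow> real"
  where "dd_weight A i j =
    (if i = j then (A $ i $ i - (\<Sum>l\<in>UNIV - {i}. \<bar>A $ i $ l\<bar>)) / 4 else \<bar>A $ i $ j\<bar> / 2)"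

definition dd_sign :: "real^'n^'n \<Rightarrow> 'n \<Rightarrow> 'n \<Rightarrow> real"
  where "dd_sign A i j = (if i \<noteq> j \<and> A $ i $ j < 0 then - 1 else 1)"

lemma DD_decomposition:
  fixes A :: "real^'n^'n"
  assumes sym: "A \<in> sym_mats"
  shows "A = (\<Sum>(i, j)\<in>UNIV.
    dd_weight A i j *\<^sub>R vec_vecT (std_basis i + dd_sign A i j *\<^sub>R std_basis j))"
proof -
  have A_sym: "A $ i $ j = A $ j $ i" for i j
    using sym by (auto simp: sym_mats_def transpose_def vec_eq_iff)
  have row: "2 * (\<Sum>j\<in>UNIV. dd_weight A k j) + 2 * (dd_sign A k k * dd_weight A k k) = A $ k $ k"
    for k
  proof -
    have "(\<Sum>j\<in>UNIV. dd_weight A k j) = dd_weight A k k + (\<Sum>j\<in>UNIV - {k}. dd_weight A k j)"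
      by (simp add: sum.remove)
    also have "(\<Sum>j\<in>UNIV - {k}. dd_weight A k j) = (\<Sum>j\<in>UNIV - {k}. \<bar>A $ k $ j\<bar>) / 2"
      by (auto simp: dd_weight_def sum_divide_distrib intro: sum.cong)
    finally show ?thesis
      by (simp add: dd_weight_def dd_sign_def field_simps)
  qed
  have off: "2 * (dd_sign A k l * dd_weight A k l) = A $ k $ l" if "k \<noteq> l" for k l
    using that by (simp add: dd_weight_def dd_sign_def)
  have w_sym: "dd_weight A i j = dd_weight A j i" for i j
    using A_sym[of i j] by (simp add: dd_weight_def)
  have s_sym: "dd_sign A i j = dd_sign A j i" for i j
    using A_sym[of i j] by (auto simp: dd_sign_def)
  have s_sq: "dd_sign A i j * dd_sign A i j = 1" for i j
    by (simp add: dd_sign_def)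
  show ?thesis
    unfolding vec_eq_iff symmetric_sum_entry[OF w_sym s_sym s_sq] using row off by simp
qed

lemma DD_subset_conical_hull: "DD \<subseteq> conical_hull (B_plus \<union> B_minus)"
proof
  fix A :: "real^'n::{finite,linorder}^'n::{finite,linorder}"
  assume A: "A \<in> DD"
  have "0 \<le> dd_weight A i j" for i j
    using A by (simp add: dd_weight_def DD_def)
  moreover have "vec_vecT (std_basis i + dd_sign A i j *\<^sub>R std_basis j) \<in> B_plus \<union> B_minus" for i j
    by (rule std_basis_pair_in_B) (simp add: dd_sign_def)
  ultimately have "(\<Sum>p\<in>UNIV. (case p of (i, j) \<Rightarrow> dd_weight A i j) *\<^sub>R
      (case p of (i, j) \<Rightarrow> vec_vecT (std_basis i + dd_sign A i j *\<^sub>R std_basis j)))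
      \<in> conical_hull (B_plus \<union> B_minus)"
    by (intro sum_in_conical_hull) (auto simp del: Un_iff)
  moreover have "A \<in> sym_mats"
    using A by (simp add: DD_def)
  ultimately show "A \<in> conical_hull (B_plus \<union> B_minus)"
    using DD_decomposition[of A] by (simp add: case_prod_beta)
qed

theorem proposition3p2:
  shows "conical_hull (B_plus \<union> B_minus) = (DD :: (real^'n::{finite,linorder}^'n::{finite,linorder}) set)"
proof
  show "conical_hull (B_plus \<union> B_minus) \<subseteq> (DD :: (real^'n::{finite,linorder}^'n::{finite,linorder}) set)"
    by (rule conical_hull_subset[OF B_subset_DD zero_in_DD add_in_DD scaleR_in_DD])
  show "DD \<subseteq> conical_hull (B_plus \<union> B_minus :: (real^'n::{finite,linorder}^'n::{finite,linorder}) set)"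
    by (rule DD_subset_conical_hull)
qed

end
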